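(* Let $K$ be a field of characteristic zero, let $k$ be a positive integer, let $x_1,\dots,x_k$ be independent variables, and let $s_1,\dots,s_k$ denote the elementary symmetric polynomials in $x_1,\dots,x_k$ of degrees $1,2,\dots,k$ respectively. Then, in the polynomial ring $K[x_1,\dots,x_k]$, for each positive integer $n$, \[ \sum_{r_1+\cdots+r_k=n} x_1^{r_1}x_2^{r_2}\cdots x_k^{r_k} =\sum_{2i_2+3i_3+\cdots+ki_k\le n} c(i_2,\dots,i_k,n)\, s_1^{\,n-2i_2-3i_3-\cdots-ki_k}\,(-s_2)^{i_2}s_3^{i_3}\cdots\big((-1)^{k-1}s_k\big)^{i_k}, \] where \[ c(i_2,\dots,i_k,n)=\frac{(n-i_2-2i_3-\cdots-(k-1)i_k)!}{i_2!\cdots i_k!\,(n-2i_2-3i_3-\cdots-ki_k)!}. \]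
   Context: The sum on the left is over all $k$-tuples $(r_1,\dots,r_k)$ of nonnegative integers with $r_1+\cdots+r_k=n$. The sum on the right is over all tuples $(i_2,\dots,i_k)$ of nonnegative integers with $2i_2+3i_3+\cdots+ki_k\le n$. The elementary symmetric polynomial of degree $j$ is $s_j=\sum_{1\le m_1<\cdots<m_j\le k}x_{m_1}\cdots x_{m_j}$. *)

theory Defs
  imports Complex_Main "HOL-Library.Poly_Mapping" "HOL-Library.FuncSet"
begin

text \<open>
  Polynomials over \<open>'a\<close> in the variables \<open>x\<^sub>0, x\<^sub>1, x\<^sub>2, \<dots>\<close> are finitely supported maps from
  exponent vectors \<open>nat \<Rightarrow>\<^sub>0 nat\<close> to coefficients, with the convolution product of
  \<^theory>\<open>HOL-Library.Poly_Mapping\<close>.  The ring \<open>K[x\<^sub>1, \<dots>, x\<^sub>k]\<close> is the subring of those polynomials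
  in which only \<open>x\<^sub>1, \<dots>, x\<^sub>k\<close> occur, so an identity between two of its elements is an equation in
  this type.
\<close>

type_synonym 'a mpolynomial = "(nat \<Rightarrow>\<^sub>0 nat) \<Rightarrow>\<^sub>0 'a"

definition Var :: "nat \<Rightarrow> 'a::comm_ring_1 mpolynomial"
  where "Var m = Poly_Mapping.single (Poly_Mapping.single m 1) 1"

definition Const :: "'a \<Rightarrow> 'a::comm_ring_1 mpolynomial"
  where "Const a = Poly_Mapping.single 0 a"

text \<open>A subset \<open>M\<close> of \<open>{1..k}\<close> with \<open>j\<close> elements stands for the sequence \<open>m\<^sub>1 < \<dots> < m\<^sub>j\<close> of its
  elements.\<close>

definition elem_sym :: "nat \<Rightarrow> nat \<Rightarrow> 'a::comm_ring_1 mpolynomial"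
  where "elem_sym k j = (\<Sum>M | M \<subseteq> {1..k} \<and> card M = j. \<Prod>m\<in>M. Var m)"

text \<open>Tuples \<open>(r\<^sub>1, \<dots>, r\<^sub>k)\<close> and \<open>(i\<^sub>2, \<dots>, i\<^sub>k)\<close> are extensional functions on \<open>{1..k}\<close> and \<open>{2..k}\<close>;
  for \<open>k = 1\<close> there is exactly one (empty) tuple of the second kind.\<close>

definition compositions :: "nat \<Rightarrow> nat \<Rightarrow> (nat \<Rightarrow> nat) set"
  where "compositions k n = {r \<in> {1..k} \<rightarrow>\<^sub>E UNIV. (\<Sum>j=1..k. r j) = n}"

definition weighted_tuples :: "nat \<Rightarrow> nat \<Rightarrow> (nat \<Rightarrow> nat) set"
  where "weighted_tuples k n = {i \<in> {2..k} \<rightarrow>\<^sub>E UNIV. (\<Sum>j=2..k. j * i j) \<le> n}"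

text \<open>On \<open>weighted_tuples k n\<close> neither of the two subtractions on natural numbers truncates.\<close>

definition coeff_c :: "nat \<Rightarrow> (nat \<Rightarrow> nat) \<Rightarrow> nat \<Rightarrow> 'a::field_char_0"
  where "coeff_c k i n =
    fact (n - (\<Sum>j=2..k. (j - 1) * i j)) /
    ((\<Prod>j=2..k. fact (i j)) * fact (n - (\<Sum>j=2..k. j * i j)))"

lemma finite_compositions: "finite (compositions k n)"
proof (rule finite_subset)
  show "compositions k n \<subseteq> {1..k} \<rightarrow>\<^sub>E {..n}"
  proof
    fix r assume "r \<in> compositions k n"
    then have r: "r \<in> {1..k} \<rightarrow>\<^sub>E UNIV" and n: "(\<Sum>j=1..k. r j) = n"
      by (auto simp: compositions_def)
    have "r j \<le> n" if "j \<in> {1..k}" for j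
      using member_le_sum[of j "{1..k}" r] that n by simp
    with r show "r \<in> {1..k} \<rightarrow>\<^sub>E {..n}"
      by (auto simp: PiE_iff)
  qed
qed (simp add: finite_PiE)

lemma finite_weighted_tuples: "finite (weighted_tuples k n)"
proof (rule finite_subset)
  show "weighted_tuples k n \<subseteq> {2..k} \<rightarrow>\<^sub>E {..n}"
  proof
    fix i assume "i \<in> weighted_tuples k n"
    then have i: "i \<in> {2..k} \<rightarrow>\<^sub>E UNIV" and n: "(\<Sum>j=2..k. j * i j) \<le> n"
      by (auto simp: weighted_tuples_def)
    have "i j \<le> n" if j: "j \<in> {2..k}" for j
    proof -
      have "i j \<le> j * i j" using j by simp
      also have "\<dots> \<le> (\<Sum>j=2..k. j * i j)"
        using member_le_sum[of j "{2..k}" "\<lambda>j. j * i j"] j by simp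
      finally show ?thesis using n by simp
    qed
    with i show "i \<in> {2..k} \<rightarrow>\<^sub>E {..n}"
      by (auto simp: PiE_iff)
  qed
qed (simp add: finite_PiE)

end

theory Submission
  imports Defs "HOL-Computational_Algebra.Formal_Power_Series"
begin

text \<open>
  Let \<open>E = (1 - x\<^sub>1 t) \<cdots> (1 - x\<^sub>k t) = 1 - (y\<^sub>1 t + \<cdots> + y\<^sub>k t\<^sup>k)\<close> with
  \<open>y\<^sub>j = (-1)\<^sup>j\<^sup>-\<^sup>1 s\<^sub>j\<close>.  The left-hand sides are the coefficients of a power series \<open>H\<close> with
  \<open>H E = 1\<close>.  On the right, put \<open>i\<^sub>1 = n - 2 i\<^sub>2 - \<cdots> - k i\<^sub>k\<close>: then \<open>c\<close> is the multinomial
  coefficient of \<open>(i\<^sub>1, \<dots>, i\<^sub>k)\<close>, and Pascal's rule for multinomial coefficients says that the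
  right-hand sides are the coefficients of a power series \<open>S\<close> with \<open>S E = 1\<close>.  Hence \<open>H = S\<close>.
\<close>

subsection \<open>Tuples of given weight\<close>

text \<open>Index set and weights are left general so that one notion serves both sides: weights 1
  give the exponents \<open>r\<close> on the left, weights \<open>j\<close> give \<open>i\<close> on
  the right once \<open>i 1\<close> is restored.\<close>

definition tuples_of_weight :: "'b set \<Rightarrow> ('b \<Rightarrow> nat) \<Rightarrow> nat \<Rightarrow> ('b \<Rightarrow> nat) set"
  where "tuples_of_weight A w n = {i \<in> A \<rightarrow>\<^sub>E UNIV. (\<Sum>j\<in>A. w j * i j) = n}"

lemma finite_tuples_of_weight:
  assumes "finite A" and "\<And>j. j \<in> A \<Longrightarrow> 0 < w j"
  shows "finite (tuples_of_weight A w n)"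
proof (rule finite_subset)
  show "tuples_of_weight A w n \<subseteq> A \<rightarrow>\<^sub>E {..n}"
  proof
    fix i assume "i \<in> tuples_of_weight A w n"
    then have i: "i \<in> A \<rightarrow>\<^sub>E UNIV" and n: "(\<Sum>j\<in>A. w j * i j) = n"
      by (auto simp: tuples_of_weight_def)
    have "i j \<le> n" if j: "j \<in> A" for j
    proof -
      have "i j \<le> w j * i j" using assms(2)[OF j] by simp
      also have "\<dots> \<le> n"
        using member_le_sum[of j A "\<lambda>j. w j * i j"] j assms(1) n by simp
      finally show ?thesis .
    qed
    with i show "i \<in> A \<rightarrow>\<^sub>E {..n}" by (auto simp: PiE_iff)
  qed
qed (use assms in \<open>simp add: finite_PiE\<close>)

text \<open>If \<open>w a \<le> n\<close>, lowering the entry at \<open>a\<close> by one is a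
  bijection onto the tuples of weight \<open>n - w a\<close>; otherwise a positive entry at
  \<open>a\<close> is already too heavy. Both recurrences below rest on this shift.\<close>

lemma sum_tuples_of_weight_pos:
  assumes "finite A" and "a \<in> A"
  shows "(\<Sum>i | i \<in> tuples_of_weight A w n \<and> 0 < i a. f i) =
    (if n < w a then 0 else \<Sum>i\<in>tuples_of_weight A w (n - w a). f (i(a := Suc (i a))))"
proof -
  have weight: "(\<Sum>j\<in>A. w j * i j) = w a * i a + (\<Sum>j\<in>A - {a}. w j * i j)" for i
    using assms by (simp add: sum.remove)
  have upd: "(\<Sum>j\<in>A - {a}. w j * (i(a := m)) j) = (\<Sum>j\<in>A - {a}. w j * i j)" for i m
    by (rule sum.cong) auto
  show ?thesis
  proof (cases "n < w a")
    case True
    have "\<not> 0 < i a" if "i \<in> tuples_of_weight A w n" for i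
    proof
      assume "0 < i a"
      then have "w a \<le> w a * i a" by simp
      also have "\<dots> \<le> n"
        using that weight[of i] by (auto simp: tuples_of_weight_def)
      finally show False using True by simp
    qed
    then have "{i. i \<in> tuples_of_weight A w n \<and> 0 < i a} = {}" by blast
    then show ?thesis using True by (simp only: sum.empty if_True)
  next
    case False
    have "(\<Sum>i | i \<in> tuples_of_weight A w n \<and> 0 < i a. f i) =
      (\<Sum>i\<in>tuples_of_weight A w (n - w a). f (i(a := Suc (i a))))"
    proof (rule sum.reindex_bij_witness[where i = "\<lambda>i. i(a := Suc (i a))"
          and j = "\<lambda>i. i(a := i a - 1)"])
      fix i assume i: "i \<in> {i. i \<in> tuples_of_weight A w n \<and> 0 < i a}"
      then obtain m where m: "i a = Suc m" by (cases "i a") auto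
      show "i(a := i a - 1) \<in> tuples_of_weight A w (n - w a)"
        using i assms(2) m by (auto simp: tuples_of_weight_def weight upd PiE_iff extensional_def)
    next
      fix i assume "i \<in> tuples_of_weight A w (n - w a)"
      then show "i(a := Suc (i a)) \<in> {i. i \<in> tuples_of_weight A w n \<and> 0 < i a}"
        using assms(2) False
        by (auto simp: tuples_of_weight_def weight upd PiE_iff extensional_def)
    qed auto
    then show ?thesis using False by simp
  qed
qed

lemma sum_tuples_of_weight_insert_0:
  assumes "finite A" and "a \<notin> A"
  shows "(\<Sum>i | i \<in> tuples_of_weight (insert a A) w n \<and> i a = 0. f i) =
    (\<Sum>i\<in>tuples_of_weight A w n. f (i(a := 0)))"
proof -
  have upd: "(\<Sum>j\<in>A. w j * (i(a := m)) j) = (\<Sum>j\<in>A. w j * i j)" for i m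
    using assms by (intro sum.cong) auto
  show ?thesis
    by (rule sum.reindex_bij_witness[where i = "\<lambda>i. i(a := 0)"
          and j = "\<lambda>i. i(a := undefined)"])
      (use assms upd in \<open>auto simp: tuples_of_weight_def PiE_iff extensional_def fun_upd_idem\<close>)
qed

subsection \<open>Complete homogeneous polynomials\<close>

text \<open>This is the complete homogeneous symmetric polynomial of degree \<open>n\<close>, over
  any index set so that induction on the set of variables is possible.\<close>

definition complete_sym :: "'b set \<Rightarrow> ('b \<Rightarrow> 'a::comm_ring_1) \<Rightarrow> nat \<Rightarrow> 'a"
  where "complete_sym A x n = (\<Sum>r\<in>tuples_of_weight A (\<lambda>_. 1) n. \<Prod>j\<in>A. x j ^ r j)"

text \<open>Split the monomials by whether the exponent of \<open>x a\<close> vanishes; if it does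
  not, one factor \<open>x a\<close> can be taken out.\<close>

lemma complete_sym_insert:
  assumes "finite A" and "a \<notin> A"
  shows "complete_sym (insert a A) x n =
    complete_sym A x n + (if n = 0 then 0 else x a * complete_sym (insert a A) x (n - 1))"
proof -
  let ?T = "tuples_of_weight (insert a A) (\<lambda>_. 1) n"
  let ?f = "\<lambda>r. \<Prod>j\<in>insert a A. x j ^ r j"
  have fin: "finite ?T"
    using assms by (intro finite_tuples_of_weight) auto
  have prod_upd: "(\<Prod>j\<in>A. x j ^ (r(a := m)) j) = (\<Prod>j\<in>A. x j ^ r j)" for r m
    using assms by (intro prod.cong) auto
  have "sum ?f ?T = sum ?f {r. r \<in> ?T \<and> r a = 0} + sum ?f {r. r \<in> ?T \<and> 0 < r a}"
    using fin by (subst sum.union_disjoint[symmetric]) (auto intro!: sum.cong)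
  also have "sum ?f {r. r \<in> ?T \<and> r a = 0} = complete_sym A x n"
    using assms prod_upd by (simp add: sum_tuples_of_weight_insert_0 complete_sym_def)
  also have "sum ?f {r. r \<in> ?T \<and> 0 < r a} =
      (if n = 0 then 0 else x a * complete_sym (insert a A) x (n - 1))"
    using assms prod_upd
    by (simp add: sum_tuples_of_weight_pos complete_sym_def sum_distrib_left mult.assoc)
  finally show ?thesis by (simp add: complete_sym_def)
qed

text \<open>Induction on \<open>A\<close>: the preceding recurrence says that multiplying the series
  for \<open>insert a A\<close> by \<open>1 - x a * t\<close> gives the series for
  \<open>A\<close>.\<close>

lemma fps_complete_sym_mult:
  fixes x :: "'b \<Rightarrow> 'a::comm_ring_1"
  assumes "finite A"
  shows "Abs_fps (complete_sym A x) * (\<Prod>j\<in>A. 1 - fps_const (x j) * fps_X) = 1"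
  using assms
proof (induction A rule: finite_induct)
  case empty
  have "complete_sym {} x n = (if n = 0 then 1 else 0)" for n
    by (simp add: complete_sym_def tuples_of_weight_def)
  then show ?case by (simp add: fps_eq_iff)
next
  case (insert a A)
  let ?H = "Abs_fps (complete_sym (insert a A) x)"
  have "?H * (1 - fps_const (x a) * fps_X) = ?H - fps_const (x a) * (fps_X * ?H)"
    by (simp add: algebra_simps)
  also have "\<dots> = Abs_fps (complete_sym A x)"
    using complete_sym_insert[OF insert.hyps, of x] by (simp add: fps_eq_iff)
  finally show ?case
    using insert by (simp add: mult.assoc[symmetric])
qed

text \<open>Vieta's formula: in expanding the product, \<open>M\<close> is the set of factors from
  which \<open>- x j * t\<close> is chosen, and it contributes to degree \<open>card M\<close>
  only.\<close>

lemma fps_nth_prod_one_minus: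
  fixes x :: "'b \<Rightarrow> 'a::comm_ring_1"
  assumes "finite A"
  shows "fps_nth (\<Prod>j\<in>A. 1 - fps_const (x j) * fps_X) n =
    (- 1) ^ n * (\<Sum>M | M \<subseteq> A \<and> card M = n. \<Prod>m\<in>M. x m)"
proof -
  have prod_const: "(\<Prod>m\<in>M. fps_const (x m)) = fps_const (\<Prod>m\<in>M. x m)" for M
    by (induction M rule: infinite_finite_induct) auto
  have sign: "(- 1) ^ c = fps_const ((- 1) ^ c :: 'a)" for c
    by (induction c) auto
  have "(\<Prod>j\<in>A. 1 - fps_const (x j) * fps_X) =
      (\<Sum>M\<in>Pow A. (- 1) ^ card M * (\<Prod>m\<in>M. fps_const (x m) * fps_X) * (\<Prod>m\<in>A - M. 1))"
    using assms by (rule prod_diff_conv_sum)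
  also have "\<dots> = (\<Sum>M\<in>Pow A. fps_const ((- 1) ^ card M * (\<Prod>m\<in>M. x m)) * fps_X ^ card M)"
    unfolding prod.distrib prod_const prod_constant sign fps_const_mult[symmetric]
    by (simp only: power_one mult_1_right mult.assoc)
  finally have "fps_nth (\<Prod>j\<in>A. 1 - fps_const (x j) * fps_X) n =
      (\<Sum>M\<in>Pow A. (- 1) ^ card M * (\<Prod>m\<in>M. x m) * (if n = card M then 1 else 0))"
    by (simp only: fps_sum_nth fps_mult_left_const_nth fps_X_power_nth)
  also have "\<dots> = (\<Sum>M\<in>Pow A. if card M = n then (- 1) ^ n * (\<Prod>m\<in>M. x m) else 0)"
    by (rule sum.cong) auto
  also have "\<dots> = (- 1) ^ n * (\<Sum>M | M \<subseteq> A \<and> card M = n. \<Prod>m\<in>M. x m)"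
    using assms by (simp add: sum_distrib_left flip: sum.inter_filter)
  finally show ?thesis .
qed

lemma prod_one_minus_Var:
  "(\<Prod>j=1..k. 1 - fps_const (Var j :: 'a::comm_ring_1 mpolynomial) * fps_X) =
    1 - (\<Sum>j=1..k. fps_const ((- 1) ^ (j - 1) * elem_sym k j) * fps_X ^ j)"
    (is "?E = 1 - ?Y")
proof (rule fps_ext)
  fix n
  have E: "fps_nth ?E n = (- 1) ^ n * elem_sym k n"
    unfolding elem_sym_def by (rule fps_nth_prod_one_minus) simp
  have "fps_nth ?Y n = (\<Sum>j=1..k. if n = j then (- 1) ^ (j - 1) * elem_sym k j else 0)"
    unfolding fps_sum_nth by (rule sum.cong) auto
  also have "\<dots> = (if n \<in> {1..k} then (- 1) ^ (n - 1) * elem_sym k n else 0)"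
    by (rule sum.delta') simp
  finally have Y: "fps_nth ?Y n = \<dots>" .
  consider "n = 0" | "n \<in> {1..k}" | "k < n" by force
  then show "fps_nth ?E n = fps_nth (1 - ?Y) n"
  proof cases
    case 1
    \<comment> \<open>Infinite sets also have \<open>card\<close> 0, hence the appeal to
      finiteness.\<close>
    have "{M. M \<subseteq> {1..k} \<and> card M = 0} = {{}}"
      by (auto simp: card_eq_0_iff dest: finite_subset)
    then have "elem_sym k 0 = (1 :: 'a mpolynomial)"
      by (simp add: elem_sym_def)
    then show ?thesis
      unfolding E fps_sub_nth Y using 1 by simp
  next
    case 2
    then show ?thesis
      unfolding E fps_sub_nth Y by (cases n) auto
  next
    case 3
    have "card M \<noteq> n" if "M \<subseteq> {1..k}" for M
      using card_mono[OF _ that] 3 by simp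
    then have "{M. M \<subseteq> {1..k} \<and> card M = n} = {}"
      by blast
    then have "elem_sym k n = (0 :: 'a mpolynomial)"
      by (simp only: elem_sym_def sum.empty)
    then show ?thesis
      unfolding E fps_sub_nth Y using 3 by simp
  qed
qed

subsection \<open>Multinomial sums\<close>

definition multinomial :: "'b set \<Rightarrow> ('b \<Rightarrow> nat) \<Rightarrow> 'a::field_char_0"
  where "multinomial A i = fact (\<Sum>j\<in>A. i j) / (\<Prod>j\<in>A. fact (i j))"

text \<open>With \<open>N\<close> the sum and \<open>P\<close> the product of the factorials of the
  entries, the term for \<open>j\<close> is \<open>i j * (N - 1)! / P\<close>. Summing over
  \<open>j\<close> turns the factor \<open>i j\<close> into \<open>N\<close>, and
  \<open>N * (N - 1)! = N!\<close> because \<open>N > 0\<close>.\<close>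

lemma multinomial_pascal:
  assumes "finite A" and "0 < (\<Sum>j\<in>A. i j)"
  shows "multinomial A i =
    (\<Sum>j\<in>A. if 0 < i j then multinomial A (i(j := i j - 1)) else 0 :: 'a::field_char_0)"
proof -
  let ?N = "\<Sum>j\<in>A. i j"
  let ?P = "\<Prod>j\<in>A. fact (i j) :: 'a"
  have "(if 0 < i j then multinomial A (i(j := i j - 1)) else 0) = of_nat (i j) * (fact (?N - 1) / ?P)"
    if j: "j \<in> A" for j
  proof (cases "i j")
    case (Suc m)
    let ?i = "i(j := m)"
    have "?N = i j + (\<Sum>l\<in>A - {j}. i l)"
      using assms(1) j by (rule sum.remove)
    moreover have "(\<Sum>l\<in>A. ?i l) = ?i j + (\<Sum>l\<in>A - {j}. ?i l)"
      using assms(1) j by (rule sum.remove)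
    moreover have "(\<Sum>l\<in>A - {j}. ?i l) = (\<Sum>l\<in>A - {j}. i l)"
      by (rule sum.cong) auto
    ultimately have "(\<Sum>l\<in>A. ?i l) = ?N - 1" using Suc by simp
    moreover have "?P = of_nat (i j) * (\<Prod>l\<in>A. fact (?i l))"
    proof -
      have "(\<Prod>l\<in>A - {j}. fact (?i l) :: 'a) = (\<Prod>l\<in>A - {j}. fact (i l))"
        by (rule prod.cong) auto
      then show ?thesis
        using Suc by (simp add: prod.remove[OF assms(1) j] mult.assoc)
    qed
    \<comment> \<open>Characteristic zero enters here: the factor \<open>i j\<close> may be
      cancelled.\<close>
    moreover have "of_nat (i j) \<noteq> (0 :: 'a)" using Suc by (simp del: of_nat_Suc)
    ultimately show ?thesis using Suc by (simp add: multinomial_def)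
  qed simp
  then have "(\<Sum>j\<in>A. if 0 < i j then multinomial A (i(j := i j - 1)) else 0) =
      (\<Sum>j\<in>A. of_nat (i j) * (fact (?N - 1) / ?P))"
    by (intro sum.cong) auto
  also have "\<dots> = of_nat ?N * fact (?N - 1) / ?P"
    by (simp add: sum_distrib_right sum_divide_distrib)
  also have "of_nat ?N * fact (?N - 1) = (fact ?N :: 'a)"
    using assms(2) by (simp add: fact_reduce)
  finally show ?thesis by (simp add: multinomial_def)
qed

lemma Const_0 [simp]: "Const 0 = 0"
  and Const_1 [simp]: "Const 1 = 1"
  and Const_add: "Const (a + b) = Const a + Const b"
  by (simp_all add: Const_def single_add)

lemma Const_sum: "Const (sum f A) = (\<Sum>j\<in>A. Const (f j))"
  by (induction A rule: infinite_finite_induct) (simp_all add: Const_add)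

text \<open>By the multinomial theorem this is the coefficient of \<open>t^n\<close> in the
  geometric series of \<open>Y\<close>, the sum of all \<open>y j * t^(w j)\<close>, that is, in
  \<open>1 / (1 - Y)\<close>.\<close>

definition multinomial_sum ::
    "'b set \<Rightarrow> ('b \<Rightarrow> nat) \<Rightarrow> ('b \<Rightarrow> 'a::field_char_0 mpolynomial) \<Rightarrow> nat \<Rightarrow> 'a mpolynomial"
  where "multinomial_sum A w y n =
    (\<Sum>i\<in>tuples_of_weight A w n. Const (multinomial A i) * (\<Prod>j\<in>A. y j ^ i j))"

lemma multinomial_sum_0:
  assumes "finite A" and "\<And>j. j \<in> A \<Longrightarrow> 0 < w j"
  shows "multinomial_sum A w y 0 = 1"
proof -
  \<comment> \<open>Positive weights leave only the zero tuple.\<close>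
  have "tuples_of_weight A w 0 = {\<lambda>j\<in>A. 0}"
    using assms by (force simp: tuples_of_weight_def PiE_iff extensional_def fun_eq_iff)
  then show ?thesis by (simp add: multinomial_sum_def multinomial_def)
qed

text \<open>Apply Pascal's rule to every coefficient and exchange the sums. For fixed
  \<open>j\<close>, shifting the entry at \<open>j\<close> restores the multinomial coefficient of
  the smaller tuple and frees one factor \<open>y j\<close>.\<close>

lemma multinomial_sum_rec:
  fixes y :: "'b \<Rightarrow> 'a::field_char_0 mpolynomial"
  assumes "finite A" and pos: "\<And>j. j \<in> A \<Longrightarrow> 0 < w j" and "0 < n"
  shows "multinomial_sum A w y n =
    (\<Sum>j\<in>A. if n < w j then 0 else y j * multinomial_sum A w y (n - w j))"
proof -
  let ?T = "tuples_of_weight A w n"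
  let ?y = "\<lambda>i. \<Prod>j\<in>A. y j ^ i j"
  have fin: "finite ?T" using assms by (intro finite_tuples_of_weight)
  have "Const (multinomial A i) * ?y i =
      (\<Sum>j\<in>A. if 0 < i j then Const (multinomial A (i(j := i j - 1))) * ?y i else 0)"
    if "i \<in> ?T" for i
  proof -
    \<comment> \<open>Pascal's rule fails for the zero tuple, which is excluded since its weight is
      0 and \<open>n\<close> is positive.\<close>
    have "0 < (\<Sum>j\<in>A. i j)"
    proof (rule ccontr)
      assume "\<not> ?thesis"
      then have "(\<Sum>j\<in>A. w j * i j) = 0" using assms(1) by simp
      then show False using that assms(3) by (simp add: tuples_of_weight_def)
    qed
    then have "Const (multinomial A i :: 'a) =
        (\<Sum>j\<in>A. if 0 < i j then Const (multinomial A (i(j := i j - 1))) else 0)"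
      by (subst multinomial_pascal[OF assms(1)]) (auto simp: Const_sum intro!: sum.cong)
    then show ?thesis
      by (simp only: sum_distrib_right) (rule sum.cong, simp_all)
  qed
  then have "multinomial_sum A w y n =
      (\<Sum>i\<in>?T. \<Sum>j\<in>A. if 0 < i j then Const (multinomial A (i(j := i j - 1))) * ?y i else 0)"
    by (simp add: multinomial_sum_def)
  also have "\<dots> =
      (\<Sum>j\<in>A. \<Sum>i\<in>?T. if 0 < i j then Const (multinomial A (i(j := i j - 1))) * ?y i else 0)"
    by (rule sum.swap)
  also have "\<dots> = (\<Sum>j\<in>A. if n < w j then 0 else y j * multinomial_sum A w y (n - w j))"
  proof (rule sum.cong)
    fix j assume j: "j \<in> A"
    have y_upd: "?y (i(j := Suc (i j))) = y j * ?y i" for i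
    proof -
      have "(\<Prod>l\<in>A - {j}. y l ^ (i(j := Suc (i j))) l) = (\<Prod>l\<in>A - {j}. y l ^ i l)"
        by (rule prod.cong) auto
      then show ?thesis by (simp add: prod.remove[OF assms(1) j] mult.assoc)
    qed
    have "(\<Sum>i\<in>?T. if 0 < i j then Const (multinomial A (i(j := i j - 1))) * ?y i else 0) =
        (\<Sum>i | i \<in> ?T \<and> 0 < i j. Const (multinomial A (i(j := i j - 1))) * ?y i)"
      using fin by (rule sum.inter_filter[symmetric])
    also have "\<dots> = (if n < w j then 0 else y j * multinomial_sum A w y (n - w j))"
      unfolding sum_tuples_of_weight_pos[OF assms(1) j] y_upd
      by (simp add: multinomial_sum_def sum_distrib_left mult.left_commute)
    finally show "(\<Sum>i\<in>?T. if 0 < i j then Const (multinomial A (i(j := i j - 1))) * ?y i else 0) =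
        (if n < w j then 0 else y j * multinomial_sum A w y (n - w j))" .
  qed simp
  finally show ?thesis .
qed

text \<open>In positive degrees the recurrence says that \<open>?S\<close> and
  \<open>?S * ?Y\<close> agree; in degree 0 they differ by 1, as \<open>?Y\<close> has no constant
  term.\<close>

lemma fps_multinomial_sum_mult:
  assumes "finite A" and "\<And>j. j \<in> A \<Longrightarrow> 0 < w j"
  shows "Abs_fps (multinomial_sum A w y) * (1 - (\<Sum>j\<in>A. fps_const (y j) * fps_X ^ w j)) = 1"
    (is "?S * (1 - ?Y) = 1")
proof (rule fps_ext)
  fix n
  have "?S * ?Y = (\<Sum>j\<in>A. fps_const (y j) * (?S * fps_X ^ w j))"
    by (simp add: sum_distrib_left mult.left_commute)
  then have "fps_nth (?S * ?Y) n =
      (\<Sum>j\<in>A. y j * (if n < w j then 0 else multinomial_sum A w y (n - w j)))"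
    by (simp add: fps_sum_nth fps_X_power_mult_right_nth cong: if_cong)
  also have "\<dots> = (\<Sum>j\<in>A. if n < w j then 0 else y j * multinomial_sum A w y (n - w j))"
    by (rule sum.cong) auto
  finally have SY: "fps_nth (?S * ?Y) n = \<dots>" .
  show "fps_nth (?S * (1 - ?Y)) n = fps_nth 1 n"
    unfolding right_diff_distrib fps_sub_nth SY
    using assms multinomial_sum_0[of A w y] multinomial_sum_rec[of A w n y]
    by (cases "n = 0") simp_all
qed

text \<open>The slack in the inequality defining \<open>weighted_tuples\<close> becomes the entry at
  1, of weight 1. This makes the weight exactly \<open>n\<close>, and restriction to
  \<open>{2..k}\<close> is the inverse map.\<close>

lemma sum_weighted_tuples_eq_multinomial_sum:
  assumes "1 \<le> k"
  shows "(\<Sum>i\<in>weighted_tuples k n.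
      Const (coeff_c k i n :: 'a::field_char_0) * y 1 ^ (n - (\<Sum>j=2..k. j * i j))
      * (\<Prod>j=2..k. y j ^ i j)) = multinomial_sum {1..k} (\<lambda>j. j) y n"
  unfolding multinomial_sum_def
proof (rule sum.reindex_bij_witness[where i = "\<lambda>i. restrict i {2..k}"
      and j = "\<lambda>i. i(1 := n - (\<Sum>j=2..k. j * i j))"])
  have "{1..k} = insert 1 {2..k}" using assms by auto
  \<comment> \<open>The second version is for goals in which the simplifier has already turned
    \<open>1\<close> into \<open>Suc 0\<close>.\<close>
  note split = this this[unfolded One_nat_def]
  have sum_upd: "(\<Sum>j=2..k. g j ((i(1 := m)) j)) = (\<Sum>j=2..k. g j (i j))"
    for g :: "nat \<Rightarrow> nat \<Rightarrow> nat" and i m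
    by (rule sum.cong) auto
  fix i
  {
    assume "i \<in> weighted_tuples k n"
    then have i: "i \<in> {2..k} \<rightarrow>\<^sub>E UNIV" and le: "(\<Sum>j=2..k. j * i j) \<le> n"
      by (auto simp: weighted_tuples_def)
    let ?m = "n - (\<Sum>j=2..k. j * i j)"
    let ?i = "i(1 := ?m)"
    show "restrict ?i {2..k} = i"
      using i by (auto simp: fun_eq_iff PiE_iff extensional_def)
    show "?i \<in> tuples_of_weight {1..k} (\<lambda>j. j) n"
      using i le sum_upd[of "\<lambda>j m. j * m" i ?m]
      by (simp add: tuples_of_weight_def split PiE_iff extensional_def)
    \<comment> \<open>Hence the entries of \<open>?i\<close> add up to the number whose factorial is
      the numerator of \<open>coeff_c\<close>.\<close>
    have "(\<Sum>j=2..k. j * i j) = (\<Sum>j=2..k. (j - 1) * i j + i j)"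
      by (rule sum.cong) (auto simp: algebra_simps)
    then have "(\<Sum>j\<in>{1..k}. ?i j) = n - (\<Sum>j=2..k. (j - 1) * i j)"
      using le sum_upd[of "\<lambda>_ m. m"] by (simp add: split sum.distrib)
    moreover have "(\<Prod>j\<in>{1..k}. fact (?i j) :: 'a) = (\<Prod>j=2..k. fact (i j)) * fact ?m"
      unfolding split by (simp add: mult.commute)
    ultimately have "multinomial {1..k} ?i = (coeff_c k i n :: 'a)"
      by (simp add: multinomial_def coeff_c_def)
    moreover have "(\<Prod>j\<in>{1..k}. y j ^ ?i j) = y 1 ^ ?m * (\<Prod>j=2..k. y j ^ i j)"
      unfolding split by simp
    ultimately show "Const (multinomial {1..k} ?i) * (\<Prod>j\<in>{1..k}. y j ^ ?i j) =
        Const (coeff_c k i n :: 'a) * y 1 ^ ?m * (\<Prod>j=2..k. y j ^ i j)"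
      by (simp add: mult.assoc)
  next
    assume "i \<in> tuples_of_weight {1..k} (\<lambda>j. j) n"
    then have i: "i \<in> {1..k} \<rightarrow>\<^sub>E UNIV" and n: "i 1 + (\<Sum>j=2..k. j * i j) = n"
      by (auto simp: tuples_of_weight_def split)
    show "restrict i {2..k} \<in> weighted_tuples k n"
      using n by (auto simp: weighted_tuples_def)
    show "(restrict i {2..k})(1 := n - (\<Sum>j=2..k. j * restrict i {2..k} j)) = i"
      using i n by (auto simp: fun_eq_iff PiE_iff extensional_def split)
  }
qed

theorem theorem1:
  fixes k n :: nat
  assumes "k \<ge> 1" and "n \<ge> 1"
  shows "(\<Sum>r\<in>compositions k n. \<Prod>j=1..k. Var j ^ r j) =
    (\<Sum>i\<in>weighted_tuples k n.
      Const (coeff_c k i n :: 'a::field_char_0)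
      * elem_sym k 1 ^ (n - (\<Sum>j=2..k. j * i j))
      * (\<Prod>j=2..k. ((- 1) ^ (j - 1) * elem_sym k j) ^ i j))"
proof -
  let ?y = "\<lambda>j. (- 1) ^ (j - 1) * elem_sym k j :: 'a mpolynomial"
  let ?H = "Abs_fps (complete_sym {1..k} Var) :: 'a mpolynomial fps"
  let ?S = "Abs_fps (multinomial_sum {1..k} (\<lambda>j. j) ?y)"
  let ?E = "1 - (\<Sum>j=1..k. fps_const (?y j) * fps_X ^ j)"
  have "?H * ?E = 1"
    using fps_complete_sym_mult[of "{1..k}" Var] by (simp only: prod_one_minus_Var) simp
  moreover have "?S * ?E = 1"
    by (rule fps_multinomial_sum_mult) auto
  \<comment> \<open>Uniqueness of inverses:
    \<open>?H = ?H * (?E * ?S) = (?H * ?E) * ?S = ?S\<close>.\<close>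
  ultimately have "?H = ?S"
    using mult.assoc[of ?H ?E ?S] by (simp only: mult.commute[of ?E ?S] mult_1_left mult_1_right)
  then have "complete_sym {1..k} Var n = multinomial_sum {1..k} (\<lambda>j. j) ?y n"
    by (simp add: fps_eq_iff)
  moreover have "compositions k n = tuples_of_weight {1..k} (\<lambda>_. 1) n"
    by (simp add: compositions_def tuples_of_weight_def)
  ultimately show ?thesis
    using sum_weighted_tuples_eq_multinomial_sum[OF assms(1), of n ?y]
    by (simp add: complete_sym_def)
qed

end
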